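(* Let $R$ be a commutative ring with identity. The following are equivalent (in (4) and (5) the condition may be read with $\tau=\tau_z^{\Delta}$ or with $\tau=\tau_z$; both versions belong to the list of equivalent conditions). (1) $|\Gamma(R)|<\infty$. (2) $R$ is a domain or $R$ is finite. (3) $R$ is a strong-$\tau_z^{\Delta}$-FFR: for every non-unit $a\in R$ there are only a finite number of non-trivial $\tau_z^{\Delta}$-factorizations of $a$. (4) $R$ is a strong-$\tau$-WFFR: for every non-unit $a\in R$ there are only a finite number of non-trivial $\tau$-divisors of $a$. (5) $R$ is a strong-$\tau$-atomic-divisor-finite ring: for every non-unit $a\in R$ there are only a finite number of $\tau$-divisors of $a$ which are $\tau$-atoms. (6) $\Gamma(R)$ has a finite number of complete subgraphs $K^r$ for $r\ge 2$.
   Context: $U(R)$ is the group of units of $R$, $R^{\#}$ is the set of non-zero non-units, and $Z(R)$ is the set of zero-divisors (including $0$). The relations $\tau_z$ and $\tau_z^{\Delta}$ on $R^{\#}$ are $a\,\tau_z\,b\Leftrightarrow ab=0$ and $a\,\tau_z^{\Delta}\,b\Leftrightarrow (ab=0\text{ and }a\ne b)$. $\Gamma(R)$ is the zero-divisor graph of $R$: the simple graph with vertex set $Z(R)\setminus\{0\}$ in which distinct $a,b$ are adjacent iff $ab=0$; $|\Gamma(R)|$ is its number of vertices; $K^r$ is the complete graph on $r$ vertices. For a symmetric relation $\tau$ on $R^{\#}$ and a non-unit $a$, a $\tau$-factorization of $a$ is an expression $a=\lambda a_1\cdots a_n$ with $n\ge 1$, $\lambda\in U(R)$, $a_i\in R^{\#}$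 and $a_i\,\tau\,a_j$ for all $i\ne j$. The factorizations $a=\lambda(\lambda^{-1}a)$ (the case $n=1$) are called trivial. $0$ may not occur as a factor of a non-trivial $\tau$-factorization, but the trivial factorizations $0=\lambda 0$ are allowed. A $\tau$-divisor of $a$ is an element occurring as a factor $a_i$ in some $\tau$-factorization of $a$; a non-trivial $\tau$-divisor of $a$ is an element occurring as a factor in some non-trivial $\tau$-factorization of $a$. A non-unit $a$ is a $\tau$-atom if for every $\tau$-factorization $a=\lambda a_1\cdots a_n$, $(a)=(a_i)$ for some $i$.
   Formalization: In (5), "τ-divisors of a" is replaced by "non-trivial τ-divisors of a": as written, (5) fails in domains such as Q[x], where all unit multiples of x are τ-divisors of x (via trivial factorizations) and τ-atoms, although (2) holds. *)

theory Defs
  imports "HOL-Algebra.Ideal" "Graph_Theory.Graph_Theory"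
begin

section \<open>Zero-divisors and the zero-divisor graph\<close>

definition nonunits :: "('a, 'm) ring_scheme \<Rightarrow> 'a set" where
  "nonunits R = carrier R - Units R"

definition nonzero_nonunits :: "('a, 'm) ring_scheme \<Rightarrow> 'a set" where
  "nonzero_nonunits R = nonunits R - {\<zero>\<^bsub>R\<^esub>}"

definition zero_divisors :: "('a, 'm) ring_scheme \<Rightarrow> 'a set" where
  "zero_divisors R =
     {a \<in> carrier R. \<exists>b \<in> carrier R. b \<noteq> \<zero>\<^bsub>R\<^esub> \<and> a \<otimes>\<^bsub>R\<^esub> b = \<zero>\<^bsub>R\<^esub>}"

text \<open>As usual in \<open>Graph_Theory\<close>, an undirected simple graph is a symmetric loop-free digraph;
  an edge between \<open>a\<close> and \<open>b\<close> is the pair of arcs \<open>(a, b)\<close> and \<open>(b, a)\<close>.\<close>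

definition zero_divisor_graph :: "('a, 'm) ring_scheme \<Rightarrow> ('a, 'a \<times> 'a) pre_digraph" where
  "zero_divisor_graph R =
     \<lparr> verts = zero_divisors R - {\<zero>\<^bsub>R\<^esub>},
       arcs = {(a, b). a \<in> zero_divisors R - {\<zero>\<^bsub>R\<^esub>} \<and> b \<in> zero_divisors R - {\<zero>\<^bsub>R\<^esub>} \<and>
                       a \<noteq> b \<and> a \<otimes>\<^bsub>R\<^esub> b = \<zero>\<^bsub>R\<^esub>},
       tail = fst, head = snd \<rparr>"

definition complete_subgraphs :: "('a, 'b) pre_digraph \<Rightarrow> nat \<Rightarrow> ('a, 'b) pre_digraph set" where
  "complete_subgraphs G r = {H. subgraph H G \<and> K\<^bsub>r\<^esub> H}"

section \<open>Factorizations with respect to a relation\<close>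

definition tau_z :: "('a, 'm) ring_scheme \<Rightarrow> ('a \<times> 'a) set" where
  "tau_z R = {(a, b). a \<in> nonzero_nonunits R \<and> b \<in> nonzero_nonunits R \<and>
                      a \<otimes>\<^bsub>R\<^esub> b = \<zero>\<^bsub>R\<^esub>}"

definition tau_z_delta :: "('a, 'm) ring_scheme \<Rightarrow> ('a \<times> 'a) set" where
  "tau_z_delta R = {(a, b). a \<in> nonzero_nonunits R \<and> b \<in> nonzero_nonunits R \<and>
                            a \<otimes>\<^bsub>R\<^esub> b = \<zero>\<^bsub>R\<^esub> \<and> a \<noteq> b}"

text \<open>The unit \<open>l\<close> and the list \<open>xs\<close> encode the expression \<open>a = l x\<^sub>1 \<cdots> x\<^sub>n\<close>, the order of the
  factors being part of the data. The alternative \<open>xs = [\<zero>]\<close> admits precisely the trivial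
  factorizations \<open>0 = l 0\<close>.\<close>

definition tau_factorization ::
    "('a, 'm) ring_scheme \<Rightarrow> ('a \<times> 'a) set \<Rightarrow> 'a \<Rightarrow> 'a \<Rightarrow> 'a list \<Rightarrow> bool" where
  "tau_factorization R \<tau> a l xs \<longleftrightarrow>
     a \<in> nonunits R \<and> l \<in> Units R \<and> xs \<noteq> [] \<and>
     (set xs \<subseteq> nonzero_nonunits R \<or> xs = [\<zero>\<^bsub>R\<^esub>]) \<and>
     a = l \<otimes>\<^bsub>R\<^esub> foldr (\<otimes>\<^bsub>R\<^esub>) xs \<one>\<^bsub>R\<^esub> \<and>
     (\<forall>i < length xs. \<forall>j < length xs. i \<noteq> j \<longrightarrow> (xs ! i, xs ! j) \<in> \<tau>)"

definition nontrivial_tau_factorization ::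
    "('a, 'm) ring_scheme \<Rightarrow> ('a \<times> 'a) set \<Rightarrow> 'a \<Rightarrow> 'a \<Rightarrow> 'a list \<Rightarrow> bool" where
  "nontrivial_tau_factorization R \<tau> a l xs \<longleftrightarrow>
     tau_factorization R \<tau> a l xs \<and> xs \<noteq> [inv\<^bsub>R\<^esub> l \<otimes>\<^bsub>R\<^esub> a]"

definition tau_divisors :: "('a, 'm) ring_scheme \<Rightarrow> ('a \<times> 'a) set \<Rightarrow> 'a \<Rightarrow> 'a set" where
  "tau_divisors R \<tau> a = {x. \<exists>l xs. tau_factorization R \<tau> a l xs \<and> x \<in> set xs}"

definition nontrivial_tau_divisors ::
    "('a, 'm) ring_scheme \<Rightarrow> ('a \<times> 'a) set \<Rightarrow> 'a \<Rightarrow> 'a set" where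
  "nontrivial_tau_divisors R \<tau> a =
     {x. \<exists>l xs. nontrivial_tau_factorization R \<tau> a l xs \<and> x \<in> set xs}"

definition tau_atom :: "('a, 'm) ring_scheme \<Rightarrow> ('a \<times> 'a) set \<Rightarrow> 'a \<Rightarrow> bool" where
  "tau_atom R \<tau> a \<longleftrightarrow> a \<in> nonunits R \<and>
     (\<forall>l xs. tau_factorization R \<tau> a l xs \<longrightarrow> (\<exists>x \<in> set xs. PIdl\<^bsub>R\<^esub> a = PIdl\<^bsub>R\<^esub> x))"

section \<open>Finiteness conditions\<close>

definition strong_tau_FFR :: "('a, 'm) ring_scheme \<Rightarrow> ('a \<times> 'a) set \<Rightarrow> bool" where
  "strong_tau_FFR R \<tau> \<longleftrightarrow>
     (\<forall>a \<in> nonunits R. finite {(l, xs). nontrivial_tau_factorization R \<tau> a l xs})"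

definition strong_tau_WFFR :: "('a, 'm) ring_scheme \<Rightarrow> ('a \<times> 'a) set \<Rightarrow> bool" where
  "strong_tau_WFFR R \<tau> \<longleftrightarrow> (\<forall>a \<in> nonunits R. finite (nontrivial_tau_divisors R \<tau> a))"

text \<open>The \<open>\<tau>\<close>-divisors counted here are those coming from non-trivial factorizations. If the
  trivial ones \<open>a = l (l\<^sup>-\<^sup>1 a)\<close> were counted too, every unit multiple of \<open>a\<close> would be a
  \<open>\<tau>\<close>-divisor of \<open>a\<close>, and the condition would fail in every domain that is not a field and has
  infinitely many units; see \<open>infinite_atomic_tau_divisors\<close> below. Counting up to associates
  instead would not characterize finite rings and domains: in \<open>\<rat>[x]/(x\<^sup>2)\<close> all non-zero
  non-units are associates.\<close>

definition strong_tau_atomic_divisor_finite ::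
    "('a, 'm) ring_scheme \<Rightarrow> ('a \<times> 'a) set \<Rightarrow> bool" where
  "strong_tau_atomic_divisor_finite R \<tau> \<longleftrightarrow>
     (\<forall>a \<in> nonunits R. finite {x \<in> nontrivial_tau_divisors R \<tau> a. tau_atom R \<tau> x})"

lemma nontrivial_tau_divisors_subset:
  "nontrivial_tau_divisors R \<tau> a \<subseteq> tau_divisors R \<tau> a"
  unfolding nontrivial_tau_divisors_def tau_divisors_def nontrivial_tau_factorization_def by blast

lemma (in domain) infinite_atomic_tau_divisors:
  assumes inf: "infinite (Units R)" and a: "a \<in> nonzero_nonunits R"
    and tau: "\<tau> = tau_z R \<or> \<tau> = tau_z_delta R"
  shows "infinite {x \<in> tau_divisors R \<tau> a. tau_atom R \<tau> x}"
proof -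
  have aR: "a \<in> carrier R" "a \<notin> Units R" "a \<noteq> \<zero>"
    using a by (auto simp: nonzero_nonunits_def nonunits_def)
  have mult: "u \<otimes> a \<in> nonzero_nonunits R" if u: "u \<in> Units R" for u
  proof -
    have ua: "inv u \<otimes> (u \<otimes> a) = a"
      using u aR by (simp add: m_assoc[symmetric] Units_closed)
    have "u \<otimes> a \<notin> Units R"
    proof
      assume "u \<otimes> a \<in> Units R"
      then have "inv u \<otimes> (u \<otimes> a) \<in> Units R"
        using u by (blast intro: Units_m_closed Units_inv_Units)
      then show False using aR(2) unfolding ua by contradiction
    qed
    moreover have "u \<otimes> a \<noteq> \<zero>"
      using ua u aR by auto
    ultimately show ?thesis
      using u aR by (auto simp: nonzero_nonunits_def nonunits_def Units_closed)
  qed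
  have no_tau: "(x, y) \<notin> \<tau>" for x y
    using tau integral by (auto simp: tau_z_def tau_z_delta_def nonzero_nonunits_def nonunits_def)
  have divisor: "u \<otimes> a \<in> tau_divisors R \<tau> a" if u: "u \<in> Units R" for u
  proof -
    have "a = inv u \<otimes> (u \<otimes> a)"
      using u aR by (simp add: m_assoc[symmetric] Units_closed)
    then have "tau_factorization R \<tau> a (inv u) [u \<otimes> a]"
      using u a mult[OF u] aR
      by (auto simp: tau_factorization_def nonzero_nonunits_def Units_closed)
    then show ?thesis unfolding tau_divisors_def by fastforce
  qed
  have atom: "tau_atom R \<tau> b" if b: "b \<in> nonzero_nonunits R" for b
    unfolding tau_atom_def
  proof (intro conjI allI impI)
    show "b \<in> nonunits R" using b by (simp add: nonzero_nonunits_def)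
    fix l xs assume f: "tau_factorization R \<tau> b l xs"
    have "length xs = 1"
    proof (rule ccontr)
      assume "length xs \<noteq> 1"
      moreover have "xs \<noteq> []" using f by (simp add: tau_factorization_def)
      ultimately have "1 < length xs" by (cases xs) auto
      then have "(xs ! 0, xs ! 1) \<in> \<tau>" using f
        unfolding tau_factorization_def by (metis less_trans zero_less_one zero_neq_one)
      with no_tau show False by blast
    qed
    then obtain x where xs: "xs = [x]" by (cases xs) auto
    have l: "l \<in> Units R" and x: "x \<in> carrier R"
      using f xs by (auto simp: tau_factorization_def nonzero_nonunits_def nonunits_def)
    have bl: "b = l \<otimes> x" using f xs x by (simp add: tau_factorization_def)
    have xb: "x = inv l \<otimes> b" using l x bl by (simp add: m_assoc[symmetric] Units_closed)
    have bR: "b \<in> carrier R" using bl l x by (simp add: Units_closed)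
    have "PIdl b \<subseteq> PIdl x"
      using bl l x by (auto simp: cgenideal_def m_assoc[symmetric] Units_closed)
    moreover have "PIdl x \<subseteq> PIdl b"
    proof
      fix y assume "y \<in> PIdl x"
      then obtain r where r: "r \<in> carrier R" "y = r \<otimes> x" by (auto simp: cgenideal_def)
      then have "y = (r \<otimes> inv l) \<otimes> b" using xb l bR by (simp add: m_assoc)
      then show "y \<in> PIdl b" using r l by (auto simp: cgenideal_def)
    qed
    ultimately show "\<exists>x \<in> set xs. PIdl b = PIdl x" using xs by auto
  qed
  have "inj_on (\<lambda>u. u \<otimes> a) (Units R)"
    using aR by (auto intro!: inj_onI simp: m_rcancel Units_closed)
  then have "infinite ((\<lambda>u. u \<otimes> a) ` Units R)"
    using inf finite_imageD by blast
  moreover have "(\<lambda>u. u \<otimes> a) ` Units R \<subseteq> {x \<in> tau_divisors R \<tau> a. tau_atom R \<tau> x}"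
    using divisor atom mult by blast
  ultimately show ?thesis using infinite_super by blast
qed

end

theory Submission
  imports Defs
begin

text \<open>Let \<open>D\<close> be the set of non-zero elements annihilated by a non-zero element other than
  themselves. A product of at least two factors that annihilate each other is \<open>0\<close>, so only \<open>0\<close> has
  non-trivial factorizations, its \<open>\<tau>\<^sub>z\<^sup>\<Delta>\<close>-divisors form \<open>D\<close>, and every non-zero non-unit is an atom.
  Each of the conditions therefore forces \<open>D\<close> to be finite. A non-zero zero-divisor \<open>x\<close> outside \<open>D\<close>
  has \<open>Rx \<subseteq> ann x = {0, x}\<close>, so that \<open>R\<close> is finite; hence \<open>D\<close> is finite only if \<open>Z(R)\<close> is.
  By the same count, a ring with finitely many and at least one non-zero zero-divisors is finite.\<close>

section \<open>Finiteness of the zero-divisors\<close>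

context cring
begin

text \<open>Multiplication by \<open>x\<close> is additive with kernel the annihilator of
  \<open>x\<close>, so its fibres are cosets of that kernel. A finite image with finite fibres
  leaves only finitely many elements.\<close>

lemma finite_carrier_if_finite_annihilator:
  assumes x: "x \<in> carrier R"
    and ann: "finite {r \<in> carrier R. r \<otimes> x = \<zero>}"
    and img: "finite ((\<lambda>r. r \<otimes> x) ` carrier R)"
  shows "finite (carrier R)"
proof -
  let ?f = "\<lambda>r. r \<otimes> x"
  have fibre: "finite (?f -` {z} \<inter> carrier R)" if "z \<in> ?f ` carrier R" for z
  proof -
    from that obtain s where s: "z = s \<otimes> x" "s \<in> carrier R" by (rule imageE)
    have "?f -` {z} \<inter> carrier R \<subseteq> (\<lambda>r. r \<oplus> s) ` {r \<in> carrier R. r \<otimes> x = \<zero>}"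
    proof
      fix r assume "r \<in> ?f -` {z} \<inter> carrier R"
      then have r: "r \<in> carrier R" "r \<otimes> x = s \<otimes> x" using s(1) by simp_all
      have "(r \<ominus> s) \<otimes> x = \<zero>"
        using r s(2) x by (simp add: minus_eq l_distr l_minus r_neg)
      moreover have "r = (r \<ominus> s) \<oplus> s"
        using r(1) s(2) by (simp add: minus_eq a_assoc l_neg)
      moreover have "r \<ominus> s \<in> carrier R"
        using r(1) s(2) by (rule minus_closed)
      ultimately show "r \<in> (\<lambda>r. r \<oplus> s) ` {r \<in> carrier R. r \<otimes> x = \<zero>}"
        by (intro image_eqI[where x = "r \<ominus> s"] CollectI conjI)
    qed
    then show ?thesis by (rule finite_subset[OF _ finite_imageI[OF ann]])
  qed
  have "finite (?f -` (?f ` carrier R) \<inter> carrier R)"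
    using img fibre by (rule finite_finite_vimage_IntI)
  then show ?thesis by (rule rev_finite_subset) blast
qed

lemma zero_divisors_diff_zero_subset:
  "zero_divisors R - {\<zero>} \<subseteq> nonzero_nonunits R"
proof
  fix x assume x: "x \<in> zero_divisors R - {\<zero>}"
  then obtain y where y: "y \<in> carrier R" "y \<noteq> \<zero>" "x \<otimes> y = \<zero>" and xR: "x \<in> carrier R"
    by (auto simp: zero_divisors_def)
  have "x \<notin> Units R"
  proof
    assume u: "x \<in> Units R"
    have "x \<otimes> y = x \<otimes> \<zero>" using y xR by simp
    then have "y = \<zero>" by (rule iffD1[OF Units_l_cancel[OF u y(1) zero_closed]])
    then show False using y by simp
  qed
  then show "x \<in> nonzero_nonunits R"
    using x xR by (simp add: nonzero_nonunits_def nonunits_def)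
qed

text \<open>The zero ring appears separately because \<open>domain\<close> excludes it, while its
  set of zero-divisors is empty.\<close>

lemma zero_divisors_trivial_iff:
  "zero_divisors R \<subseteq> {\<zero>} \<longleftrightarrow> domain R \<or> carrier R = {\<zero>}"
proof
  assume Z: "zero_divisors R \<subseteq> {\<zero>}"
  show "domain R \<or> carrier R = {\<zero>}"
  proof (cases "\<one> = \<zero>")
    case True
    then show ?thesis using one_zeroD by blast
  next
    case False
    have "a = \<zero> \<or> b = \<zero>" if "a \<otimes> b = \<zero>" "a \<in> carrier R" "b \<in> carrier R" for a b
      using Z that by (auto simp: zero_divisors_def)
    then show ?thesis using False by (auto intro!: domain.intro domain_axioms.intro is_cring)
  qed
next
  assume "domain R \<or> carrier R = {\<zero>}"
  then show "zero_divisors R \<subseteq> {\<zero>}"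
    using domain.integral by (fastforce simp: zero_divisors_def)
qed

lemma finite_zero_divisors_iff:
  "finite (zero_divisors R) \<longleftrightarrow> domain R \<or> finite (carrier R)"
proof
  assume Z: "finite (zero_divisors R)"
  show "domain R \<or> finite (carrier R)"
  proof (cases "zero_divisors R \<subseteq> {\<zero>}")
    case True
    then show ?thesis using zero_divisors_trivial_iff by auto
  next
    case False
    then obtain x y where xy: "x \<in> carrier R" "x \<noteq> \<zero>" "y \<in> carrier R" "y \<noteq> \<zero>" "x \<otimes> y = \<zero>"
      by (auto simp: zero_divisors_def)
    \<comment> \<open>Kernel and image of multiplication by \<open>x\<close> both consist of
      zero-divisors: \<open>x\<close> kills the former, \<open>y\<close> kills the latter.\<close>
    have "{r \<in> carrier R. r \<otimes> x = \<zero>} \<subseteq> zero_divisors R"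
      using xy by (auto simp: zero_divisors_def)
    then have ann: "finite {r \<in> carrier R. r \<otimes> x = \<zero>}" using Z by (rule finite_subset)
    have "(\<lambda>r. r \<otimes> x) ` carrier R \<subseteq> zero_divisors R"
    proof
      fix z assume "z \<in> (\<lambda>r. r \<otimes> x) ` carrier R"
      then obtain r where "z = r \<otimes> x" "r \<in> carrier R" by (rule imageE)
      then have "z \<in> carrier R" "z \<otimes> y = \<zero>" using xy by (simp_all add: m_assoc)
      then show "z \<in> zero_divisors R" using xy by (auto simp: zero_divisors_def)
    qed
    then have "finite ((\<lambda>r. r \<otimes> x) ` carrier R)" using Z by (rule finite_subset)
    with xy(1) ann have "finite (carrier R)" by (rule finite_carrier_if_finite_annihilator)
    then show ?thesis ..
  qed
next
  assume "domain R \<or> finite (carrier R)"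
  then show "finite (zero_divisors R)"
  proof
    assume "domain R"
    then show ?thesis using zero_divisors_trivial_iff finite_subset by blast
  next
    assume "finite (carrier R)"
    then show ?thesis by (simp add: zero_divisors_def)
  qed
qed

section \<open>The domains of the two annihilation relations\<close>

lemma Domain_tau_z: "Domain (tau_z R) = zero_divisors R - {\<zero>}"
proof
  show "Domain (tau_z R) \<subseteq> zero_divisors R - {\<zero>}"
    by (auto simp: tau_z_def nonzero_nonunits_def nonunits_def zero_divisors_def)
  show "zero_divisors R - {\<zero>} \<subseteq> Domain (tau_z R)"
  proof
    fix x assume x: "x \<in> zero_divisors R - {\<zero>}"
    then obtain y where y: "y \<in> carrier R" "y \<noteq> \<zero>" "x \<otimes> y = \<zero>" and xR: "x \<in> carrier R"
      by (auto simp: zero_divisors_def)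
    \<comment> \<open>The partner \<open>y\<close> is killed by the non-zero \<open>x\<close>, hence
      is itself a non-unit, as \<open>tau_z\<close> demands.\<close>
    then have "y \<in> zero_divisors R - {\<zero>}"
      using x m_comm by (auto simp: zero_divisors_def intro!: bexI[of _ x])
    then have "(x, y) \<in> tau_z R"
      using x y zero_divisors_diff_zero_subset by (auto simp: tau_z_def)
    then show "x \<in> Domain (tau_z R)" ..
  qed
qed

lemma tau_z_delta_subset: "tau_z_delta R \<subseteq> tau_z R"
  by (auto simp: tau_z_def tau_z_delta_def)

lemma sym_tau_z: "sym (tau_z R)" and sym_tau_z_delta: "sym (tau_z_delta R)"
  by (auto simp: sym_def tau_z_def tau_z_delta_def nonzero_nonunits_def nonunits_def m_comm)

text \<open>The domains of \<open>tau_z\<close> and \<open>tau_z_delta\<close> can differ: in Z/4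
  the element 2 annihilates only 0 and itself. An element missed in this way forces the whole ring
  to be finite.\<close>

lemma finite_Domain_tau_z_delta_iff:
  "finite (Domain (tau_z_delta R)) \<longleftrightarrow> finite (zero_divisors R)"
proof
  assume D: "finite (Domain (tau_z_delta R))"
  show "finite (zero_divisors R)"
  proof (cases "zero_divisors R - {\<zero>} \<subseteq> Domain (tau_z_delta R)")
    case True
    then have "finite (zero_divisors R - {\<zero>})" using D finite_subset by blast
    then show ?thesis by simp
  next
    case False
    then obtain x where x: "x \<in> zero_divisors R - {\<zero>}" "x \<notin> Domain (tau_z_delta R)" by blast
    have xR: "x \<in> carrier R" using x by (simp add: zero_divisors_def)
    have only_x: "y = x" if "(x, y) \<in> tau_z R" for y
      using that x(2) by (auto simp: tau_z_def tau_z_delta_def)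
    \<comment> \<open>Some partner of \<open>x\<close> exists and can only be \<open>x\<close>
      itself, so \<open>x\<close> has square zero.\<close>
    obtain y where "(x, y) \<in> tau_z R" using x(1) Domain_tau_z by blast
    then have xx: "x \<otimes> x = \<zero>" using only_x by (fastforce simp: tau_z_def)
    have ann: "r \<in> {\<zero>, x}" if r: "r \<in> carrier R" "r \<otimes> x = \<zero>" for r
    proof (cases "r = \<zero>")
      case False
      then have "r \<in> zero_divisors R - {\<zero>}" using r xR x(1) by (auto simp: zero_divisors_def)
      then have "(x, r) \<in> tau_z R"
        using x(1) r xR zero_divisors_diff_zero_subset by (auto simp: tau_z_def m_comm)
      then show ?thesis using only_x by simp
    qed simp
    \<comment> \<open>Square zero puts all multiples of \<open>x\<close> into its annihilator, so
      the bound on the kernel also bounds the image.\<close>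
    moreover have "(r \<otimes> x) \<otimes> x = \<zero>" if "r \<in> carrier R" for r
      using that xR xx by (simp add: m_assoc)
    ultimately have "(\<lambda>r. r \<otimes> x) ` carrier R \<subseteq> {\<zero>, x}"
      using xR by blast
    then have img: "finite ((\<lambda>r. r \<otimes> x) ` carrier R)" by (rule finite_subset) simp
    have "{r \<in> carrier R. r \<otimes> x = \<zero>} \<subseteq> {\<zero>, x}" using ann by blast
    then have "finite {r \<in> carrier R. r \<otimes> x = \<zero>}" by (rule finite_subset) simp
    with xR have "finite (carrier R)" using img by (rule finite_carrier_if_finite_annihilator)
    then show ?thesis by (simp add: zero_divisors_def)
  qed
next
  assume "finite (zero_divisors R)"
  then have "finite (Domain (tau_z R))" by (simp add: Domain_tau_z)
  then show "finite (Domain (tau_z_delta R))"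
    using tau_z_delta_subset by (meson Domain_mono finite_subset)
qed

end

section \<open>Factorizations into mutually annihilating factors\<close>

context cring
begin

lemma foldr_mult_closed:
  "set xs \<subseteq> carrier R \<Longrightarrow> foldr (\<otimes>) xs \<one> \<in> carrier R"
  by (induction xs) auto

text \<open>A single factor is determined by \<open>a\<close> and \<open>l\<close>, even when it is
  zero, so a list of length one is trivial. With more factors, the first two already multiply to
  zero.\<close>

lemma nontrivial_tau_factorizationD:
  assumes tau: "\<tau> \<subseteq> tau_z R" and f: "nontrivial_tau_factorization R \<tau> a l xs"
  shows "a = \<zero>" "2 \<le> length xs"
proof -
  have l: "l \<in> Units R" and ne: "xs \<noteq> []"
    and xs: "set xs \<subseteq> nonzero_nonunits R \<or> xs = [\<zero>]"
    and al: "a = l \<otimes> foldr (\<otimes>) xs \<one>"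
    and rel: "\<And>i j. i < length xs \<Longrightarrow> j < length xs \<Longrightarrow> i \<noteq> j \<Longrightarrow> (xs ! i, xs ! j) \<in> \<tau>"
    and nontriv: "xs \<noteq> [inv l \<otimes> a]"
    using f by (auto simp: nontrivial_tau_factorization_def tau_factorization_def)
  have xsR: "set xs \<subseteq> carrier R"
    using xs by (auto simp: nonzero_nonunits_def nonunits_def)
  obtain x ys where x: "xs = x # ys" using ne by (cases xs) auto
  have "ys \<noteq> []"
  proof
    assume "ys = []"
    then have "a = l \<otimes> x" using al x xsR by simp
    then have "inv l \<otimes> a = x" using l x xsR by (simp add: m_assoc[symmetric] Units_closed)
    then show False using nontriv x \<open>ys = []\<close> by simp
  qed
  then obtain y zs where xyz: "xs = x # y # zs" using x by (cases ys) auto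
  show "2 \<le> length xs" using xyz by simp
  have "(x, y) \<in> tau_z R" using rel[of 0 1] tau xyz by auto
  then have "x \<otimes> y = \<zero>" by (simp add: tau_z_def)
  moreover have "foldr (\<otimes>) zs \<one> \<in> carrier R" "x \<in> carrier R" "y \<in> carrier R"
    using xsR xyz foldr_mult_closed by auto
  ultimately have "foldr (\<otimes>) xs \<one> = \<zero>" using xyz by (simp add: m_assoc[symmetric])
  then show "a = \<zero>" using al l by (simp add: Units_closed)
qed

text \<open>Zero is a unit only in the zero ring, which has no non-zero elements. This makes
  factorizations of zero admissible, since only non-units are factored.\<close>

lemma zero_in_nonunits:
  assumes "nonzero_nonunits R \<noteq> {}"
  shows "\<zero> \<in> nonunits R"
proof -
  have "\<zero> \<notin> Units R"
  proof
    assume "\<zero> \<in> Units R"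
    then have "\<one> = inv \<zero> \<otimes> \<zero>" by (rule Units_l_inv[symmetric])
    also have "\<dots> = \<zero>" using \<open>\<zero> \<in> Units R\<close> by (intro r_null Units_inv_closed)
    finally have "carrier R = {\<zero>}" by (rule one_zeroD)
    then show False using assms by (auto simp: nonzero_nonunits_def nonunits_def)
  qed
  then show ?thesis by (simp add: nonunits_def)
qed

lemma nontrivial_tau_factorization_pair:
  assumes tau: "\<tau> \<subseteq> tau_z R" "sym \<tau>" and xy: "(x, y) \<in> \<tau>"
  shows "nontrivial_tau_factorization R \<tau> \<zero> \<one> [x, y]"
proof -
  have "x \<in> nonzero_nonunits R" "y \<in> nonzero_nonunits R" "x \<otimes> y = \<zero>"
    using xy tau(1) by (auto simp: tau_z_def)
  \<comment> \<open>The condition on the factors runs over ordered pairs of indices, so both orders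
    are required.\<close>
  moreover have "(y, x) \<in> \<tau>" using xy tau(2) by (blast dest: symD)
  ultimately show ?thesis
    using xy zero_in_nonunits
    by (auto simp: nontrivial_tau_factorization_def tau_factorization_def less_Suc_eq
        nonzero_nonunits_def nonunits_def)
qed

text \<open>In a list of length at least two each factor is related to the one at some other
  position; conversely, a related pair is itself a factorization of zero with unit
  \<open>\<one>\<close>.\<close>

lemma nontrivial_tau_divisors_eq:
  assumes tau: "\<tau> \<subseteq> tau_z R" "sym \<tau>"
  shows "nontrivial_tau_divisors R \<tau> a = (if a = \<zero> then Domain \<tau> else {})"
proof -
  have "x \<in> Domain \<tau>" if f: "nontrivial_tau_factorization R \<tau> a l xs" and "x \<in> set xs" for x l xs
  proof -
    obtain i where i: "i < length xs" "x = xs ! i" using \<open>x \<in> set xs\<close> by (auto simp: in_set_conv_nth)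
    \<comment> \<open>Any position other than \<open>i\<close> would do; length at least two keeps
      this one in range.\<close>
    define j :: nat where "j = (if i = 0 then 1 else 0)"
    have "j < length xs" "i \<noteq> j"
      using nontrivial_tau_factorizationD(2)[OF tau(1) f] by (auto simp: j_def)
    then have "(x, xs ! j) \<in> \<tau>"
      using f i by (simp add: nontrivial_tau_factorization_def tau_factorization_def)
    then show ?thesis ..
  qed
  moreover have "x \<in> nontrivial_tau_divisors R \<tau> \<zero>" if "(x, y) \<in> \<tau>" for x y
    using nontrivial_tau_factorization_pair[OF tau that]
    unfolding nontrivial_tau_divisors_def by fastforce
  ultimately show ?thesis
    using nontrivial_tau_factorizationD(1)[OF tau(1)]
    by (auto simp: nontrivial_tau_divisors_def)
qed

text \<open>Only zero has non-trivial factorizations, and the one factor of a trivial factorization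
  is an associate of \<open>a\<close>.\<close>

lemma nonzero_nonunit_tau_atom:
  assumes tau: "\<tau> \<subseteq> tau_z R" and a: "a \<in> nonzero_nonunits R"
  shows "tau_atom R \<tau> a"
  unfolding tau_atom_def
proof (intro conjI allI impI)
  show "a \<in> nonunits R" using a by (simp add: nonzero_nonunits_def)
  fix l xs assume f: "tau_factorization R \<tau> a l xs"
  have aR: "a \<in> carrier R" "a \<noteq> \<zero>"
    using a by (auto simp: nonzero_nonunits_def nonunits_def)
  have l: "l \<in> Units R" using f by (simp add: tau_factorization_def)
  have xs: "xs = [inv l \<otimes> a]"
    using f aR nontrivial_tau_factorizationD(1)[OF tau]
    unfolding nontrivial_tau_factorization_def by blast
  have "PIdl a \<subseteq> PIdl (inv l \<otimes> a)"
  proof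
    fix y assume "y \<in> PIdl a"
    then obtain r where r: "r \<in> carrier R" "y = r \<otimes> a" by (auto simp: cgenideal_def)
    \<comment> \<open>The unit is absorbed into the coefficient; \<open>l \<otimes> inv l\<close>
      stays uncancelled here so that both sides reassociate to the same product.\<close>
    have "(r \<otimes> l) \<otimes> (inv l \<otimes> a) = r \<otimes> (l \<otimes> inv l \<otimes> a)"
      using r l aR by (simp add: m_assoc Units_closed del: Units_r_inv)
    then have "y = (r \<otimes> l) \<otimes> (inv l \<otimes> a)"
      using r l aR by simp
    then show "y \<in> PIdl (inv l \<otimes> a)"
      using r l by (auto simp: cgenideal_def Units_closed)
  qed
  moreover have "PIdl (inv l \<otimes> a) \<subseteq> PIdl a"
    using l aR by (auto simp: cgenideal_def m_assoc[symmetric])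
  ultimately show "\<exists>x \<in> set xs. PIdl a = PIdl x" using xs by auto
qed

section \<open>The finiteness conditions in terms of the domain of the relation\<close>

lemma strong_tau_WFFR_iff:
  assumes tau: "\<tau> \<subseteq> tau_z R" "sym \<tau>"
  shows "strong_tau_WFFR R \<tau> \<longleftrightarrow> finite (Domain \<tau>)"
proof (cases "\<zero> \<in> nonunits R")
  case True
  then show ?thesis using nontrivial_tau_divisors_eq[OF tau] by (auto simp: strong_tau_WFFR_def)
next
  case False
  \<comment> \<open>If zero is a unit, the condition does not inspect the divisors of zero, but then
    no non-zero non-units exist and the domain is empty as well.\<close>
  then have "Domain \<tau> = {}" using tau(1) zero_in_nonunits by (auto simp: tau_z_def)
  then show ?thesis using nontrivial_tau_divisors_eq[OF tau] by (simp add: strong_tau_WFFR_def)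
qed

text \<open>Non-trivial divisors are non-zero non-units, hence all atoms, so restricting to atoms
  discards nothing.\<close>

lemma strong_tau_atomic_divisor_finite_iff:
  assumes tau: "\<tau> \<subseteq> tau_z R" "sym \<tau>"
  shows "strong_tau_atomic_divisor_finite R \<tau> \<longleftrightarrow> strong_tau_WFFR R \<tau>"
proof -
  have "Domain \<tau> \<subseteq> nonzero_nonunits R" using tau(1) by (auto simp: tau_z_def)
  then have "{x \<in> nontrivial_tau_divisors R \<tau> a. tau_atom R \<tau> x} = nontrivial_tau_divisors R \<tau> a"
    for a
    using nonzero_nonunit_tau_atom[OF tau(1)] nontrivial_tau_divisors_eq[OF tau, of a] by auto
  then show ?thesis by (simp add: strong_tau_atomic_divisor_finite_def strong_tau_WFFR_def)
qed

text \<open>The divisors are the entries of finitely many lists.\<close>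

lemma strong_tau_FFR_imp_WFFR:
  assumes "strong_tau_FFR R \<tau>"
  shows "strong_tau_WFFR R \<tau>"
  unfolding strong_tau_WFFR_def
proof
  fix a assume "a \<in> nonunits R"
  then have "finite {(l, xs). nontrivial_tau_factorization R \<tau> a l xs}"
    using assms by (simp add: strong_tau_FFR_def)
  then have "finite (\<Union>(l, xs) \<in> {(l, xs). nontrivial_tau_factorization R \<tau> a l xs}. set xs)"
    by (intro finite_UN_I) auto
  then show "finite (nontrivial_tau_divisors R \<tau> a)"
    by (rule rev_finite_subset) (auto simp: nontrivial_tau_divisors_def)
qed

text \<open>Distinctness of related elements makes the lists repetition-free, which bounds their
  length. For \<open>tau_z\<close> this fails: in Z/4 zero is a product of arbitrarily many factors
  2.\<close>

lemma finite_carrier_imp_strong_tau_z_delta_FFR: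
  assumes "finite (carrier R)"
  shows "strong_tau_FFR R (tau_z_delta R)"
  unfolding strong_tau_FFR_def
proof
  fix a
  have "{(l, xs). nontrivial_tau_factorization R (tau_z_delta R) a l xs}
    \<subseteq> carrier R \<times> {xs. set xs \<subseteq> carrier R \<and> distinct xs}"
    by (auto simp: nontrivial_tau_factorization_def tau_factorization_def distinct_conv_nth
        tau_z_delta_def nonzero_nonunits_def nonunits_def Units_closed)
  moreover have "finite (carrier R \<times> {xs. set xs \<subseteq> carrier R \<and> distinct xs})"
    using assms by (simp add: finite_subset_distinct)
  ultimately show "finite {(l, xs). nontrivial_tau_factorization R (tau_z_delta R) a l xs}"
    by (rule finite_subset)
qed

lemma domain_imp_strong_tau_FFR:
  assumes "domain R" and tau: "\<tau> \<subseteq> tau_z R" "sym \<tau>"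
  shows "strong_tau_FFR R \<tau>"
proof -
  have "zero_divisors R \<subseteq> {\<zero>}"
    using assms(1) by (simp add: zero_divisors_trivial_iff)
  then have "Domain \<tau> = {}"
    using Domain_mono[OF tau(1)] by (auto simp: Domain_tau_z)
  then have no_divisor: "nontrivial_tau_divisors R \<tau> a = {}" for a
    by (simp add: nontrivial_tau_divisors_eq[OF tau])
  have "\<not> nontrivial_tau_factorization R \<tau> a l xs" for a l xs
  proof
    assume f: "nontrivial_tau_factorization R \<tau> a l xs"
    \<comment> \<open>Every entry of \<open>xs\<close> would be a non-trivial divisor, and there are
      none.\<close>
    then have "set xs \<subseteq> {}"
      unfolding no_divisor[of a, symmetric] by (auto simp: nontrivial_tau_divisors_def)
    then show False using nontrivial_tau_factorizationD(2)[OF tau(1) f] by simp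
  qed
  then show ?thesis by (simp add: strong_tau_FFR_def)
qed

end

section \<open>Complete subgraphs of the zero-divisor graph\<close>

text \<open>A subgraph inherits the \<open>tail\<close> and \<open>head\<close> maps of
  \<open>G\<close>, so its vertex and arc sets determine it.\<close>

lemma finite_subgraphs:
  assumes "finite (verts G)" "finite (arcs G)"
  shows "finite {H. subgraph H G}"
proof -
  have "{H. subgraph H G} \<subseteq>
    (\<lambda>(V, A). \<lparr>verts = V, arcs = A, tail = tail G, head = head G\<rparr>) ` (Pow (verts G) \<times> Pow (arcs G))"
  proof
    fix H assume "H \<in> {H. subgraph H G}"
    then have "H = (\<lambda>(V, A). \<lparr>verts = V, arcs = A, tail = tail G, head = head G\<rparr>) (verts H, arcs H)"
      "(verts H, arcs H) \<in> Pow (verts G) \<times> Pow (arcs G)"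
      by (auto simp: subgraph_def compatible_def)
    then show "H \<in> (\<lambda>(V, A). \<lparr>verts = V, arcs = A, tail = tail G, head = head G\<rparr>) `
      (Pow (verts G) \<times> Pow (arcs G))" by (rule image_eqI)
  qed
  then show ?thesis using assms by (meson finite_Pow_iff finite_SigmaI finite_imageI finite_subset)
qed

context cring
begin

lemma verts_zero_divisor_graph: "verts (zero_divisor_graph R) = zero_divisors R - {\<zero>}"
  by (simp add: zero_divisor_graph_def)

text \<open>By symmetry second components lie in the domain of \<open>tau_z\<close> too.\<close>

lemma tau_z_delta_subset_Times:
  "tau_z_delta R \<subseteq> (zero_divisors R - {\<zero>}) \<times> (zero_divisors R - {\<zero>})"
proof (rule subrelI)
  fix a b assume ab: "(a, b) \<in> tau_z_delta R"
  have "(a, b) \<in> tau_z R" "(b, a) \<in> tau_z R"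
    using ab symD[OF sym_tau_z_delta ab] tau_z_delta_subset by (simp_all only: subset_iff)
  then have "a \<in> Domain (tau_z R)" "b \<in> Domain (tau_z R)" by (simp_all only: DomainI)
  then show "(a, b) \<in> (zero_divisors R - {\<zero>}) \<times> (zero_divisors R - {\<zero>})"
    by (simp only: Domain_tau_z mem_Times_iff fst_conv snd_conv)
qed

text \<open>The graph asks its endpoints to be zero-divisors, the relation asks for non-units; for
  non-zero elements with product zero both hold.\<close>

lemma arcs_zero_divisor_graph: "arcs (zero_divisor_graph R) = tau_z_delta R"
proof -
  let ?V = "zero_divisors R - {\<zero>}"
  have "arcs (zero_divisor_graph R) = {(a, b). a \<noteq> b \<and> a \<otimes> b = \<zero>} \<inter> ?V \<times> ?V"
    by (auto simp: zero_divisor_graph_def)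
  also have "?V \<times> ?V = nonzero_nonunits R \<times> nonzero_nonunits R \<inter> ?V \<times> ?V"
    using zero_divisors_diff_zero_subset
    by (intro inf.absorb2[symmetric] Sigma_mono)
  also have "{(a, b). a \<noteq> b \<and> a \<otimes> b = \<zero>} \<inter> \<dots> = tau_z_delta R \<inter> ?V \<times> ?V"
    by (auto simp: tau_z_delta_def)
  also have "\<dots> = tau_z_delta R"
    by (rule inf.absorb1[OF tau_z_delta_subset_Times])
  finally show ?thesis .
qed

lemma wf_zero_divisor_graph: "wf_digraph (zero_divisor_graph R)"
  by unfold_locales (auto simp: zero_divisor_graph_def)

text \<open>Turns each element of the domain of \<open>tau_z_delta\<close> into a vertex of some
  \<open>K^2\<close>.\<close>

lemma edge_in_complete_subgraphs:
  assumes "(x, y) \<in> tau_z_delta R"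
  shows "\<lparr>verts = {x, y}, arcs = {(x, y), (y, x)}, tail = fst, head = snd\<rparr>
    \<in> complete_subgraphs (zero_divisor_graph R) 2" (is "?H \<in> _")
proof -
  have yx: "(y, x) \<in> tau_z_delta R" using assms sym_tau_z_delta by (blast dest: symD)
  have neq: "x \<noteq> y" using assms by (simp add: tau_z_delta_def)
  have ends: "arcs_ends ?H = {(x, y), (y, x)}"
    by (simp add: arcs_ends_def arc_to_ends_def)
  have wf: "wf_digraph ?H" by unfold_locales auto
  have "verts ?H \<subseteq> verts (zero_divisor_graph R)"
    using assms tau_z_delta_subset_Times unfolding verts_zero_divisor_graph by auto
  moreover have "arcs ?H \<subseteq> arcs (zero_divisor_graph R)"
    using assms yx unfolding arcs_zero_divisor_graph by simp
  moreover have "compatible (zero_divisor_graph R) ?H"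
    by (simp add: compatible_def zero_divisor_graph_def)
  ultimately have "subgraph ?H (zero_divisor_graph R)"
    unfolding subgraph_def using wf wf_zero_divisor_graph by (intro conjI)
  \<comment> \<open>Distinctness of \<open>x\<close> and \<open>y\<close> rules out loops.\<close>
  moreover have "graph ?H"
    by unfold_locales (use neq in \<open>auto simp: arc_to_ends_def symmetric_def ends sym_def\<close>)
  ultimately show ?thesis
    using neq ends by (auto simp: complete_subgraphs_def complete_digraph_def)
qed

text \<open>Complete subgraphs with at least two vertices miss isolated vertices such as 2 in Z/4,
  so they control only the domain of \<open>tau_z_delta\<close>; its finiteness still suffices.
  Conversely, a finite graph has finitely many subgraphs.\<close>

lemma finite_complete_subgraphs_iff:
  "finite (\<Union>r \<in> {2..}. complete_subgraphs (zero_divisor_graph R) r) \<longleftrightarrow> finite (zero_divisors R)"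
    (is "finite ?C \<longleftrightarrow> _")
proof
  assume "finite ?C"
  moreover have "finite (verts H)" if "H \<in> ?C" for H
  proof -
    have "graph H" using that unfolding complete_subgraphs_def complete_digraph_def by blast
    then interpret H: graph H .
    show ?thesis by (rule H.finite_verts)
  qed
  ultimately have "finite (\<Union>H \<in> ?C. verts H)" by (rule finite_UN_I)
  moreover have "Domain (tau_z_delta R) \<subseteq> (\<Union>H \<in> ?C. verts H)"
  proof
    fix x assume "x \<in> Domain (tau_z_delta R)"
    then obtain y where "(x, y) \<in> tau_z_delta R" ..
    then have "\<lparr>verts = {x, y}, arcs = {(x, y), (y, x)}, tail = fst, head = snd\<rparr> \<in> ?C"
      by (intro UN_I[of 2] edge_in_complete_subgraphs) simp_all
    then show "x \<in> (\<Union>H \<in> ?C. verts H)" by (rule UN_I) simp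
  qed
  ultimately have "finite (Domain (tau_z_delta R))" by (rule rev_finite_subset)
  then show "finite (zero_divisors R)" by (simp add: finite_Domain_tau_z_delta_iff)
next
  assume fin: "finite (zero_divisors R)"
  then have "finite (tau_z_delta R)"
    using finite_subset[OF tau_z_delta_subset_Times] by simp
  then have fin_sub: "finite {H. subgraph H (zero_divisor_graph R)}"
    using fin by (intro finite_subgraphs) (simp_all add: verts_zero_divisor_graph arcs_zero_divisor_graph)
  have "?C \<subseteq> {H. subgraph H (zero_divisor_graph R)}"
    unfolding complete_subgraphs_def by (intro UN_least Collect_mono impI) (rule conjunct1)
  then show "finite ?C" using fin_sub by (rule finite_subset)
qed

end

theorem theorem5p3:
  fixes R :: "('a, 'm) ring_scheme"
  assumes "cring R"
  shows
    "(finite (verts (zero_divisor_graph R)) \<longleftrightarrow> domain R \<or> finite (carrier R)) \<and>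
     (finite (verts (zero_divisor_graph R)) \<longleftrightarrow> strong_tau_FFR R (tau_z_delta R)) \<and>
     (finite (verts (zero_divisor_graph R)) \<longleftrightarrow> strong_tau_WFFR R (tau_z_delta R)) \<and>
     (finite (verts (zero_divisor_graph R)) \<longleftrightarrow> strong_tau_WFFR R (tau_z R)) \<and>
     (finite (verts (zero_divisor_graph R)) \<longleftrightarrow>
        strong_tau_atomic_divisor_finite R (tau_z_delta R)) \<and>
     (finite (verts (zero_divisor_graph R)) \<longleftrightarrow>
        strong_tau_atomic_divisor_finite R (tau_z R)) \<and>
     (finite (verts (zero_divisor_graph R)) \<longleftrightarrow>
        finite (\<Union>r \<in> {2..}. complete_subgraphs (zero_divisor_graph R) r))"
proof -
  interpret cring R by fact
  have verts: "finite (verts (zero_divisor_graph R)) \<longleftrightarrow> finite (zero_divisors R)"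
    by (simp add: verts_zero_divisor_graph)
  have delta: "strong_tau_WFFR R (tau_z_delta R) \<longleftrightarrow> finite (zero_divisors R)"
    using strong_tau_WFFR_iff[OF tau_z_delta_subset sym_tau_z_delta]
    by (simp add: finite_Domain_tau_z_delta_iff)
  have z: "strong_tau_WFFR R (tau_z R) \<longleftrightarrow> finite (zero_divisors R)"
    using strong_tau_WFFR_iff[OF subset_refl sym_tau_z] by (simp add: Domain_tau_z)
  \<comment> \<open>The implications form a cycle: finitely many factorizations, finitely many
    divisors, finitely many zero-divisors, domain or finite ring, and back.\<close>
  have FFR: "strong_tau_FFR R (tau_z_delta R) \<longleftrightarrow> finite (zero_divisors R)"
    using strong_tau_FFR_imp_WFFR delta finite_zero_divisors_iff
      finite_carrier_imp_strong_tau_z_delta_FFR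
      domain_imp_strong_tau_FFR[OF _ tau_z_delta_subset sym_tau_z_delta]
    by blast
  show ?thesis
    unfolding verts FFR delta z finite_complete_subgraphs_iff
      strong_tau_atomic_divisor_finite_iff[OF tau_z_delta_subset sym_tau_z_delta]
      strong_tau_atomic_divisor_finite_iff[OF subset_refl sym_tau_z]
    by (intro conjI refl finite_zero_divisors_iff)
qed

end
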